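(* Let $(v(x,t),\theta(x,t))$ be a smooth solution on $\mathbb{R}^2\times[0,T)$, $T\in(0,\infty]$, of the 2D quasi-geostrophic equation $$\frac{\partial\theta}{\partial t}+(v\cdot\nabla)\theta=0,\qquad v=-\nabla^\perp(-\Delta)^{-1/2}\theta,\qquad\theta(x,0)=\theta_0(x),$$ with initial data satisfying $\|\nabla\theta_0\|_{L^\infty}<\infty$, which generates the particle trajectory map $\{X(\cdot,t)\}$ and the back-to-label map $A(\cdot,t)$. Set the direction vector field $\xi(x,t)=\frac{\nabla^\perp\theta(x,t)}{|\nabla^\perp\theta(x,t)|}$, and let $\{e_1(x,t),e_2(x,t)\}$ and $\{\lambda_1(x,t),\lambda_2(x,t)\}$ be the normalized eigenvectors and the corresponding eigenvalues of the matrix $$M(x,t)=(\nabla A(x,t))^T\nabla A(x,t),$$ with the order of magnitude $$\lambda_1(x,t)>\lambda_2(x,t)>0\qquad\forall (x,t).$$ Suppose there exists a sequence $\{(x_k,t_k)\}$ tending to $(\bar x,\bar t)$ as $k\to\infty$ such that $\lim_{k\to\infty}|\nabla\theta(x_k,t_k)|=\infty$. Then necessarily $$\lim_{k\to\infty}\lambda_1(x_k,t_k)=\infty,\qquad\lim_{k\to\infty}\lambda_2(x_k,t_k)=0,$$ and $$\lim_{k\to\infty}|\xi(x_k,t_k)-e_2(x_k,t_k)|=0 .$$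
   Context: Here $\theta=\theta(x_1,x_2,t)$ is a scalar (temperature), $v=(v_1,v_2)$ is the fluid velocity, and $\nabla^\perp=(-\partial_{x_2},\partial_{x_1})$. The particle trajectory map $X(\cdot,t)$ generated by $v$ is defined by $\frac{\partial X(a,t)}{\partial t}=v(X(a,t),t)$, $X(a,0)=a\in\mathbb{R}^2$; for each $t\in[0,T)$ it is a diffeomorphism, and the back-to-label map is its inverse $A(\cdot,t)=X^{-1}(\cdot,t)$. $\nabla A$ is the Jacobian matrix of $A(\cdot,t)$. The direction field $\xi$ is defined wherever $\nabla^\perp\theta\neq0$.
   Formalization: The ordering is taken as λ1 ≥ λ2 > 0 with orthonormal e1, e2, since M = I at t = 0 rules out strict inequality everywhere; and, e2 being determined only up to sign, the last limit is for |ξ − e2| with the sign of e2 chosen so that e2·ξ ≥ 0. *)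

theory Defs
  imports "HOL-Analysis.Analysis"
begin

text \<open>
  Smoothness uses derivatives within the domain, so that it also makes sense up to the initial
  time on the half-open slab \<open>UNIV \<times> {0..<T}\<close>. All domains used below are convex with nonempty
  interior, hence Frechet derivatives within them are unique.
\<close>

primrec Ck_on :: "nat \<Rightarrow> 'a::real_normed_vector set \<Rightarrow> ('a \<Rightarrow> 'b::real_normed_vector) \<Rightarrow> bool" where
  "Ck_on 0 S f \<longleftrightarrow> continuous_on S f"
| "Ck_on (Suc n) S f \<longleftrightarrow> f differentiable_on S \<and>
     (\<forall>h. Ck_on n S (\<lambda>x. frechet_derivative f (at x within S) h))"

definition smooth_on :: "'a::real_normed_vector set \<Rightarrow> ('a \<Rightarrow> 'b::real_normed_vector) \<Rightarrow> bool" where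
  "smooth_on S f \<longleftrightarrow> (\<forall>n. Ck_on n S f)"

definition time_interval :: "ereal \<Rightarrow> real set" where
  "time_interval T = {t. 0 \<le> t \<and> ereal t < T}"

definition grad :: "(real^2 \<Rightarrow> real) \<Rightarrow> real^2 \<Rightarrow> real^2" where
  "grad f x = (\<chi> i. frechet_derivative f (at x) (axis i 1))"

definition perp_grad :: "(real^2 \<Rightarrow> real) \<Rightarrow> real^2 \<Rightarrow> real^2" where
  "perp_grad f x = vector [- (grad f x $ 2), grad f x $ 1]"

text \<open>
  In the plane the Fourier multiplier \<open>1 / \<bar>k\<bar>\<close> has convolution kernel \<open>1 / (2 \<pi> \<bar>x\<bar>)\<close>.
\<close>

definition riesz_potential :: "(real^2 \<Rightarrow> real) \<Rightarrow> real^2 \<Rightarrow> real" where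
  "riesz_potential f x = (1 / (2 * pi)) * (LINT y|lborel. f y / norm (x - y))"

definition mean_zero_test :: "(real^2 \<Rightarrow> real) \<Rightarrow> bool" where
  "mean_zero_test \<phi> \<longleftrightarrow>
     smooth_on UNIV \<phi> \<and> compact (closure {x. \<phi> x \<noteq> 0}) \<and> (LINT x|lborel. \<phi> x) = 0"

text \<open>
  \<open>\<psi> = (-\<Delta>)\<^sup>-\<^sup>1\<^sup>/\<^sup>2 f\<close> in the sense of distributions: the self-adjoint operator is moved to the test
  function. The potential of a mean zero test function is \<open>O(\<bar>x\<bar>\<^sup>-\<^sup>2)\<close>, so the pairing converges
  absolutely for every continuous \<open>f\<close> in \<open>L\<^sup>p\<close>, \<open>1 \<le> p < \<infinity>\<close>, whereas the integral defining
  \<open>riesz_potential f\<close> itself may diverge for \<open>p \<ge> 2\<close>. The price is that \<open>\<psi>\<close> is determined only up to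
  an additive constant, which is irrelevant for \<open>perp_grad \<psi>\<close>.
\<close>

definition inv_sqrt_laplacian :: "(real^2 \<Rightarrow> real) \<Rightarrow> (real^2 \<Rightarrow> real) \<Rightarrow> bool" where
  "inv_sqrt_laplacian f \<psi> \<longleftrightarrow> (\<forall>\<phi>. mean_zero_test \<phi> \<longrightarrow>
     integrable lborel (\<lambda>x. \<psi> x * \<phi> x) \<and>
     integrable lborel (\<lambda>x. f x * riesz_potential \<phi> x) \<and>
     (LINT x|lborel. \<psi> x * \<phi> x) = (LINT x|lborel. f x * riesz_potential \<phi> x))"

definition smooth_sqg_solution ::
  "ereal \<Rightarrow> (real^2 \<Rightarrow> real) \<Rightarrow> (real^2 \<Rightarrow> real \<Rightarrow> real^2) \<Rightarrow> (real^2 \<Rightarrow> real \<Rightarrow> real) \<Rightarrow> bool" where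
  "smooth_sqg_solution T \<theta>0 v \<theta> \<longleftrightarrow>
     smooth_on (UNIV \<times> time_interval T) (\<lambda>(x, t). v x t) \<and>
     smooth_on (UNIV \<times> time_interval T) (\<lambda>(x, t). \<theta> x t) \<and>
     (\<forall>x. \<forall>t\<in>time_interval T.
        vector_derivative (\<theta> x) (at t within time_interval T) + v x t \<bullet> grad (\<lambda>y. \<theta> y t) x = 0) \<and>
     (\<forall>t\<in>time_interval T. \<exists>\<psi>. \<psi> differentiable_on UNIV \<and>
        inv_sqrt_laplacian (\<lambda>x. \<theta> x t) \<psi> \<and> (\<forall>x. v x t = - perp_grad \<psi> x)) \<and>
     (\<forall>x. \<theta> x 0 = \<theta>0 x)"

definition diffeomorphism_with_inverse :: "(real^2 \<Rightarrow> real^2) \<Rightarrow> (real^2 \<Rightarrow> real^2) \<Rightarrow> bool" where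
  "diffeomorphism_with_inverse F G \<longleftrightarrow>
     smooth_on UNIV F \<and> smooth_on UNIV G \<and> (\<forall>a. G (F a) = a) \<and> (\<forall>x. F (G x) = x)"

definition particle_trajectory_map ::
  "ereal \<Rightarrow> (real^2 \<Rightarrow> real \<Rightarrow> real^2) \<Rightarrow> (real^2 \<Rightarrow> real \<Rightarrow> real^2) \<Rightarrow> bool" where
  "particle_trajectory_map T v X \<longleftrightarrow>
     (\<forall>a. X a 0 = a) \<and>
     (\<forall>a. \<forall>t\<in>time_interval T. (X a has_vector_derivative v (X a t) t) (at t within time_interval T))"

definition back_to_label_map ::
  "ereal \<Rightarrow> (real^2 \<Rightarrow> real \<Rightarrow> real^2) \<Rightarrow> (real^2 \<Rightarrow> real \<Rightarrow> real^2) \<Rightarrow> bool" where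
  "back_to_label_map T X A \<longleftrightarrow>
     (\<forall>t\<in>time_interval T. diffeomorphism_with_inverse (\<lambda>a. X a t) (\<lambda>x. A x t))"

definition direction_field :: "(real^2 \<Rightarrow> real \<Rightarrow> real) \<Rightarrow> real^2 \<Rightarrow> real \<Rightarrow> real^2" where
  "direction_field \<theta> x t =
     perp_grad (\<lambda>y. \<theta> y t) x /\<^sub>R norm (perp_grad (\<lambda>y. \<theta> y t) x)"

definition spatial_jacobian :: "(real^2 \<Rightarrow> real \<Rightarrow> real^2) \<Rightarrow> real^2 \<Rightarrow> real \<Rightarrow> real^2^2" where
  "spatial_jacobian A x t = jacobian (\<lambda>y. A y t) (at x)"

definition deformation_matrix :: "(real^2 \<Rightarrow> real \<Rightarrow> real^2) \<Rightarrow> real^2 \<Rightarrow> real \<Rightarrow> real^2^2" where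
  "deformation_matrix A x t = transpose (spatial_jacobian A x t) ** spatial_jacobian A x t"

text \<open>
  For symmetric \<open>M\<close> orthogonality is automatic when \<open>l1 > l2\<close>. The equality case cannot be excluded: at the initial
  time the deformation matrix is the identity.
\<close>

definition ordered_eigensystem ::
  "real^2^2 \<Rightarrow> real \<Rightarrow> real \<Rightarrow> real^2 \<Rightarrow> real^2 \<Rightarrow> bool" where
  "ordered_eigensystem M l1 l2 e1 e2 \<longleftrightarrow>
     M *v e1 = l1 *\<^sub>R e1 \<and> M *v e2 = l2 *\<^sub>R e2 \<and>
     norm e1 = 1 \<and> norm e2 = 1 \<and> e1 \<bullet> e2 = 0 \<and> l1 \<ge> l2 \<and> l2 > 0"

text \<open>
  A normalized eigenvector is determined only up to sign; to compare it with a direction \<open>u\<close> one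
  takes the representative that does not make an obtuse angle with \<open>u\<close>.
\<close>

definition oriented_along :: "real^2 \<Rightarrow> real^2 \<Rightarrow> real^2" where
  "oriented_along u e = (if e \<bullet> u \<ge> 0 then e else - e)"

end

theory Submission
  imports Defs
begin

text \<open>
  Since \<open>\<theta>\<close> is transported, \<open>\<nabla>\<theta> = (\<nabla>A)\<^sup>T \<nabla>\<theta>\<^sub>0(A)\<close>, so \<open>\<bar>\<nabla>\<theta>\<bar>\<^sup>2 \<le> \<lambda>\<^sub>1 \<bar>\<nabla>\<theta>\<^sub>0(A)\<bar>\<^sup>2\<close> and blow-up
  of the gradient forces \<open>\<lambda>\<^sub>1 \<rightarrow> \<infinity>\<close>. The velocity is a perpendicular gradient, hence divergence free,
  so \<open>det \<nabla>A = 1\<close> and \<open>\<lambda>\<^sub>1 \<lambda>\<^sub>2 = 1\<close>. In the plane, \<open>det \<nabla>A = 1\<close> also turns the gradient identity into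
  \<open>\<nabla>A \<nabla>\<^sup>\<bottom>\<theta> = \<nabla>\<^sup>\<bottom>\<theta>\<^sub>0(A)\<close>; its squared norm is the quadratic form of \<open>M\<close> at \<open>\<nabla>\<^sup>\<bottom>\<theta>\<close>, so
  \<open>\<lambda>\<^sub>1 (\<xi> \<bullet> e\<^sub>1)\<^sup>2 \<le> \<bar>\<nabla>\<theta>\<^sub>0(A)\<bar>\<^sup>2 / \<bar>\<nabla>\<theta>\<bar>\<^sup>2\<close>, which tends to 0 and leaves only the \<open>e\<^sub>2\<close> component of \<open>\<xi>\<close>.
\<close>

section \<open>Divergence of a perpendicular gradient\<close>

text \<open>Two applications of the mean value theorem, to \<open>f s h - f s 0\<close> in
  \<open>s\<close> and then to \<open>P s\<close> in its argument, turn the second difference into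
  \<open>R\<close> at a point inside the square of side \<open>h\<close>; the squares shrink to the
  origin, where \<open>R\<close> is continuous.\<close>

lemma tendsto_mixed_difference_quotient:
  fixes f P R :: "real \<Rightarrow> real \<Rightarrow> real"
  assumes P: "\<And>s r. ((\<lambda>s. f s r) has_real_derivative P s r) (at s)"
    and R: "\<And>s r. ((\<lambda>r. P s r) has_real_derivative R s r) (at r)"
    and cont: "isCont (\<lambda>(s, r). R s r) (0, 0)"
  shows "((\<lambda>h. (f h h - f h 0 - f 0 h + f 0 0) / h\<^sup>2) \<longlongrightarrow> R 0 0) (at_right 0)"
proof (rule tendstoI)
  fix e :: real assume "e > 0"
  then obtain d where d: "d > 0"
    "\<And>z. dist z (0, 0) < d \<Longrightarrow> dist ((\<lambda>(s, r). R s r) z) (R 0 0) < e"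
    using cont unfolding continuous_at_eps_delta by fastforce
  have "dist ((f h h - f h 0 - f 0 h + f 0 0) / h\<^sup>2) (R 0 0) < e" if h: "0 < h" "h < d / 2" for h
  proof -
    obtain s where s: "0 < s" "s < h" "(f h h - f h 0) - (f 0 h - f 0 0) = (h - 0) * (P s h - P s 0)"
      using MVT2[of 0 h "\<lambda>s. f s h - f s 0" "\<lambda>s. P s h - P s 0", OF h(1) DERIV_diff[OF P P]]
      by auto
    obtain r where r: "0 < r" "r < h" "P s h - P s 0 = (h - 0) * R s r"
      using MVT2[of 0 h "P s" "R s"] h R by auto
    have "(f h h - f h 0 - f 0 h + f 0 0) / h\<^sup>2 = R s r"
      using s(3) r(3) h by (simp add: power2_eq_square field_simps)
    moreover have "dist (s, r) (0, 0) < d"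
      using sqrt_sum_squares_le_sum_abs[of s r] s r h by (auto simp: dist_Pair_Pair)
    ultimately show ?thesis using d(2)[of "(s, r)"] by simp
  qed
  then show "\<forall>\<^sub>F h in at_right 0. dist ((f h h - f h 0 - f 0 h + f 0 0) / h\<^sup>2) (R 0 0) < e"
    unfolding eventually_at_right_field using d(1) by (intro exI[of _ "d/2"]) auto
qed

text \<open>The second difference over a square is symmetric in the two variables, so both iterated
  derivatives are limits of the same quotient.\<close>

lemma mixed_partials_eq:
  fixes f P Q R1 R2 :: "real \<Rightarrow> real \<Rightarrow> real"
  assumes "\<And>s r. ((\<lambda>s. f s r) has_real_derivative P s r) (at s)"
    and "\<And>s r. ((\<lambda>r. f s r) has_real_derivative Q s r) (at r)"
    and "\<And>s r. ((\<lambda>r. P s r) has_real_derivative R1 s r) (at r)"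
    and "\<And>s r. ((\<lambda>s. Q s r) has_real_derivative R2 s r) (at s)"
    and "isCont (\<lambda>(s, r). R1 s r) (0, 0)" and "isCont (\<lambda>(s, r). R2 s r) (0, 0)"
  shows "R1 0 0 = R2 0 0"
proof -
  have swap: "isCont (\<lambda>(s, r). R2 r s) (0, 0)"
    using isCont_o2[of "(0, 0)" "\<lambda>z. (snd z, fst z)" "\<lambda>(s, r). R2 s r"] assms(6)
    by (auto simp: case_prod_unfold intro!: continuous_intros)
  have "((\<lambda>h. (f h h - f h 0 - f 0 h + f 0 0) / h\<^sup>2) \<longlongrightarrow> R1 0 0) (at_right 0)"
    using tendsto_mixed_difference_quotient assms by blast
  moreover have "((\<lambda>h. (f h h - f 0 h - f h 0 + f 0 0) / h\<^sup>2) \<longlongrightarrow> R2 0 0) (at_right 0)"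
    using tendsto_mixed_difference_quotient[of "\<lambda>r s. f s r" "\<lambda>r s. Q s r" "\<lambda>r s. R2 s r"] assms swap
    by blast
  ultimately show ?thesis
    by (intro tendsto_unique[of "at_right (0::real)" "\<lambda>h. (f h h - f h 0 - f 0 h + f 0 0) / h\<^sup>2"])
      (auto simp: algebra_simps)
qed

text \<open>\<open>\<psi>\<close> itself is only assumed differentiable, but its first partial
  derivatives are \<open>- V $ 2\<close> and \<open>V $ 1\<close>, whose derivatives are continuous.
  Zero divergence is the equality of the mixed partial derivatives of \<open>\<psi>\<close>.\<close>

lemma divergence_perp_grad_eq_0:
  fixes \<psi> :: "real^2 \<Rightarrow> real" and V :: "real^2 \<Rightarrow> real^2" and DV :: "real^2 \<Rightarrow> real^2 \<Rightarrow> real^2"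
  assumes psi: "\<psi> differentiable_on UNIV"
    and V: "\<And>x. V x = - perp_grad \<psi> x"
    and DV: "\<And>x. (V has_derivative DV x) (at x)"
    and cont: "\<And>h. continuous_on UNIV (\<lambda>x. DV x h)"
  shows "DV x (axis 1 1) $ 1 + DV x (axis 2 1) $ 2 = 0"
proof -
  \<comment> \<open>Affine coordinates centred at \<open>x\<close>: the mixed partials are compared
    at the origin.\<close>
  define p :: "real \<Rightarrow> real \<Rightarrow> real^2" where "p s r = x + s *\<^sub>R axis 1 1 + r *\<^sub>R axis 2 1" for s r
  have p1: "((\<lambda>s. p s r) has_derivative (\<lambda>h. h *\<^sub>R axis 1 1)) (at s)" for s r
    unfolding p_def by (auto intro!: derivative_eq_intros)
  have p2: "((\<lambda>r. p s r) has_derivative (\<lambda>h. h *\<^sub>R axis 2 1)) (at r)" for s r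
    unfolding p_def by (auto intro!: derivative_eq_intros)
  have dpsi: "(\<psi> has_derivative frechet_derivative \<psi> (at y)) (at y)" for y
    using psi by (simp add: differentiable_on_def frechet_derivative_works)
  have V1: "V y $ 1 = frechet_derivative \<psi> (at y) (axis 2 1)"
    and V2: "V y $ 2 = - frechet_derivative \<psi> (at y) (axis 1 1)" for y
    by (simp_all add: V perp_grad_def grad_def)
  have curve: "((\<lambda>s. g (q s)) has_real_derivative D e) (at s)"
    if "(g has_derivative D) (at (q s))" "(q has_derivative (\<lambda>h. h *\<^sub>R e)) (at s)"
    for g :: "real^2 \<Rightarrow> real" and q D e s
  proof -
    have "((\<lambda>s. g (q s)) has_derivative (\<lambda>h. D (h *\<^sub>R e))) (at s)"
      using has_derivative_compose[OF that(2,1)] .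
    moreover have "(\<lambda>h. D (h *\<^sub>R e)) = (*) (D e)"
      using linear_scale[OF has_derivative_linear[OF that(1)]] by (auto simp: mult.commute)
    ultimately show ?thesis by (simp add: has_field_derivative_def)
  qed
  have comp: "((\<lambda>y. V y $ i) has_derivative (\<lambda>h. DV y h $ i)) (at y)" for i y
    using DV by (rule bounded_linear.has_derivative[OF bounded_linear_vec_nth])
  have cont': "isCont (\<lambda>(s, r). DV (p s r) h $ i) (0, 0)" for h i
  proof -
    have "continuous_on UNIV (\<lambda>z. DV (p (fst z) (snd z)) h $ i)"
      unfolding p_def by (intro continuous_intros continuous_on_compose2[OF cont]) auto
    then show ?thesis by (simp add: continuous_on_eq_continuous_at case_prod_unfold)
  qed
  have "- DV (p 0 0) (axis 2 1) $ 2 = DV (p 0 0) (axis 1 1) $ 1"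
  proof (rule mixed_partials_eq[of "\<lambda>s r. \<psi> (p s r)" "\<lambda>s r. - V (p s r) $ 2" "\<lambda>s r. V (p s r) $ 1"
        "\<lambda>s r. - DV (p s r) (axis 2 1) $ 2" "\<lambda>s r. DV (p s r) (axis 1 1) $ 1"])
    show "isCont (\<lambda>(s, r). - DV (p s r) (axis 2 1) $ 2) (0, 0)"
      using continuous_minus[OF cont'] by (simp add: case_prod_unfold)
    show "((\<lambda>s. \<psi> (p s r)) has_real_derivative - V (p s r) $ 2) (at s)"
      and "((\<lambda>r. \<psi> (p s r)) has_real_derivative V (p s r) $ 1) (at r)" for s r
      using curve[OF dpsi p1] curve[OF dpsi p2] by (simp_all add: V1 V2)
  qed (intro DERIV_minus curve[OF comp p1] curve[OF comp p2] cont')+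
  then show ?thesis by (simp add: p_def)
qed

section \<open>Variational equation of a flow\<close>

text \<open>The Lipschitz bound is only needed in the unit tube around \<open>\<gamma>\<close>: as long as \<open>\<xi>\<close> stays in the
  tube, \<open>exp (- 2 L s) \<bar>\<xi> s - \<gamma> s\<bar>\<^sup>2\<close> decreases, so \<open>\<xi>\<close> cannot reach the boundary of the tube.\<close>

lemma trajectories_close:
  fixes v :: "'a::euclidean_space \<Rightarrow> real \<Rightarrow> 'a"
  assumes xi: "\<And>s. s \<in> {0..\<tau>} \<Longrightarrow> (\<xi> has_vector_derivative v (\<xi> s) s) (at s within {0..\<tau>})"
    and gamma: "\<And>s. s \<in> {0..\<tau>} \<Longrightarrow> (\<gamma> has_vector_derivative v (\<gamma> s) s) (at s within {0..\<tau>})"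
    and lip: "\<And>s y. s \<in> {0..\<tau>} \<Longrightarrow> norm (y - \<gamma> s) \<le> 1 \<Longrightarrow>
                norm (v y s - v (\<gamma> s) s) \<le> L * norm (y - \<gamma> s)"
    and L: "0 \<le> L"
    and small: "norm (\<xi> 0 - \<gamma> 0) * exp (L * \<tau>) < 1"
    and s: "s \<in> {0..\<tau>}"
  shows "norm (\<xi> s - \<gamma> s) < 1" and "norm (\<xi> s - \<gamma> s) \<le> norm (\<xi> 0 - \<gamma> 0) * exp (L * \<tau>)"
proof -
  define d where "d s = \<xi> s - \<gamma> s" for s
  define u where "u s = (d s \<bullet> d s) * exp (- 2 * L * s)" for s
  have d': "(d has_vector_derivative v (\<xi> s) s - v (\<gamma> s) s) (at s within {0..\<tau>})" if "s \<in> {0..\<tau>}" for s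
    unfolding d_def using xi[OF that] gamma[OF that] by (intro derivative_intros)
  have cont_d: "continuous_on {0..\<tau>} d"
    unfolding continuous_on_eq_continuous_within using d' has_vector_derivative_continuous by blast
  define u' where "u' s = 2 * (d s \<bullet> (v (\<xi> s) s - v (\<gamma> s) s) - L * (d s \<bullet> d s)) * exp (- 2 * L * s)" for s
  have u': "(u has_real_derivative u' s) (at s within {0..\<tau>})" if "s \<in> {0..\<tau>}" for s
    unfolding u_def u'_def has_field_derivative_def
    using d'[OF that] unfolding has_vector_derivative_def
    by (auto intro!: derivative_eq_intros simp: fun_eq_iff algebra_simps inner_commute)
  have u'_le: "u' s \<le> 0" if "s \<in> {0..\<tau>}" "norm (d s) \<le> 1" for s
  proof -
    have "d s \<bullet> (v (\<xi> s) s - v (\<gamma> s) s) \<le> norm (d s) * norm (v (\<xi> s) s - v (\<gamma> s) s)"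
      by (rule norm_cauchy_schwarz)
    also have "\<dots> \<le> norm (d s) * (L * norm (d s))"
      using lip[of s "\<xi> s"] that by (intro mult_left_mono) (auto simp: d_def)
    also have "\<dots> = L * (d s \<bullet> d s)"
      by (simp add: dot_square_norm power2_eq_square)
    finally show ?thesis by (simp add: u'_def mult_nonpos_nonneg)
  qed
  have bound: "norm (d q) \<le> norm (d 0) * exp (L * \<tau>)"
    if s: "q \<in> {0..\<tau>}" and le: "\<And>r. r \<in> {0..<q} \<Longrightarrow> norm (d r) \<le> 1" for q
  proof -
    have "u q \<le> u 0"
    proof (rule DERIV_nonpos_imp_decreasing_open[of 0 q u])
      show "0 \<le> q" using s by simp
      show "continuous_on {0..q} u"
        unfolding u_def using s by (intro continuous_intros continuous_on_subset[OF cont_d]) auto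
    next
      fix r assume r: "0 < r" "r < q"
      then have "(u has_real_derivative u' r) (at r within {0<..<q})"
        using s by (intro DERIV_subset[OF u']) auto
      moreover have "at r within {0<..<q} = at r"
        using r by (intro at_within_open) auto
      ultimately show "\<exists>y. DERIV u r :> y \<and> y \<le> 0"
        using u'_le[of r] le[of r] r s by auto
    qed
    then have "(norm (d q))\<^sup>2 * exp (- 2 * L * q) \<le> (norm (d 0))\<^sup>2"
      by (simp add: u_def dot_square_norm)
    then have "(norm (d q))\<^sup>2 \<le> (norm (d 0) * exp (L * q))\<^sup>2"
      by (simp add: exp_minus power_mult_distrib field_simps exp_double flip: exp_of_nat_mult)
    then have "norm (d q) \<le> norm (d 0) * exp (L * q)"
      by (rule power2_le_imp_le) simp
    also have "\<dots> \<le> norm (d 0) * exp (L * \<tau>)"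
      using s L by (intro mult_left_mono) (auto intro: mult_left_mono)
    finally show ?thesis .
  qed
  have tube: "norm (d s) < 1" if "s \<in> {0..\<tau>}" for s
  proof (rule ccontr)
    \<comment> \<open>\<open>B\<close> holds the times of distance at least 1. Before its least
      element \<open>r\<close> the distance is below 1, so \<open>bound\<close> applies at
      \<open>r\<close>, and \<open>small\<close> puts the distance there below 1 as well.\<close>
    define B where "B = {0..\<tau>} \<inter> (\<lambda>r. norm (d r)) -` {1..}"
    assume "\<not> norm (d s) < 1"
    then have "s \<in> B" using that by (simp add: B_def)
    moreover have "compact B"
      unfolding B_def compact_eq_bounded_closed
      by (intro conjI continuous_closed_preimage continuous_on_norm cont_d bounded_Int) auto
    ultimately obtain r where r: "r \<in> B" "\<And>q. q \<in> B \<Longrightarrow> r \<le> q"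
      using compact_attains_inf[of B] by auto
    have "norm (d r) \<le> norm (d 0) * exp (L * \<tau>)"
      using r by (intro bound) (force simp: B_def)+
    with small r(1) show False by (simp add: B_def d_def)
  qed
  show "norm (\<xi> s - \<gamma> s) < 1" using tube[OF s] by (simp add: d_def)
  show "norm (\<xi> s - \<gamma> s) \<le> norm (\<xi> 0 - \<gamma> 0) * exp (L * \<tau>)"
    using bound[OF s] tube s by (force simp: d_def)
qed

text \<open>Sequential form of the directional derivative, as dominated convergence requires it. By
  linearity of \<open>f'\<close> the scaled Frechet remainder is exactly the error of the
  quotient.\<close>

lemma difference_quotient_tendsto:
  fixes f :: "'a::real_normed_vector \<Rightarrow> 'b::real_normed_vector"
  assumes f: "(f has_derivative f') (at a)" and h: "h \<longlonglongrightarrow> 0" "\<And>n. h n \<noteq> (0::real)"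
  shows "(\<lambda>n. (f (a + h n *\<^sub>R e) - f a) /\<^sub>R h n) \<longlonglongrightarrow> f' e"
proof -
  have "((\<lambda>t. f (a + t *\<^sub>R e)) has_derivative (\<lambda>t. f' (t *\<^sub>R e))) (at 0)"
    by (rule has_derivative_compose[of "\<lambda>t. a + t *\<^sub>R e" _ _ _ f])
      (auto intro!: derivative_eq_intros simp: f)
  then have lim: "((\<lambda>t. norm (f (a + t *\<^sub>R e) - f a - f' (t *\<^sub>R e)) / norm t) \<longlongrightarrow> 0) (at 0)"
    by (simp add: has_derivative_at)
  have "filterlim h (at 0) sequentially"
    using h by (simp add: filterlim_at)
  from filterlim_compose[OF lim this]
  have "(\<lambda>n. norm (f (a + h n *\<^sub>R e) - f a - f' (h n *\<^sub>R e)) / norm (h n)) \<longlonglongrightarrow> 0" .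
  moreover have "norm (f (a + h n *\<^sub>R e) - f a - f' (h n *\<^sub>R e)) / norm (h n)
      = norm ((f (a + h n *\<^sub>R e) - f a) /\<^sub>R h n - f' e)" for n
  proof -
    have "f (a + h n *\<^sub>R e) - f a - f' (h n *\<^sub>R e) = h n *\<^sub>R ((f (a + h n *\<^sub>R e) - f a) /\<^sub>R h n - f' e)"
      using h(2)[of n] linear_scale[OF has_derivative_linear[OF f]] by (simp add: scaleR_diff_right)
    then show ?thesis using h(2)[of n] by simp
  qed
  ultimately show ?thesis by (simp add: tendsto_norm_zero_iff LIM_zero_iff)
qed

lemma linear_expand: "linear f \<Longrightarrow> f x = (\<Sum>b\<in>Basis. (x \<bullet> b) *\<^sub>R f b)"
  for f :: "'a::euclidean_space \<Rightarrow> 'b::real_vector"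
  using linear_sum[of f "\<lambda>b. (x \<bullet> b) *\<^sub>R b" Basis]
  by (simp add: euclidean_representation linear_scale)

text \<open>Continuity of \<open>Dv\<close> is given for each fixed direction, so compactness bounds
  it on basis vectors, and the sum of these bounds dominates the operator norm. The mean value
  inequality on the convex ball does the rest.\<close>

lemma uniformly_lipschitz_on_cball:
  fixes v :: "'a::euclidean_space \<Rightarrow> real \<Rightarrow> 'b::real_normed_vector"
  assumes Dv: "\<And>y s. s \<in> K \<Longrightarrow> ((\<lambda>y. v y s) has_derivative Dv y s) (at y)"
    and cont: "\<And>h. continuous_on (UNIV \<times> K) (\<lambda>(y, s). Dv y s h)"
    and K: "compact K"
  obtains L where "L \<ge> 0"
    and "\<And>s y z. s \<in> K \<Longrightarrow> y \<in> cball 0 R \<Longrightarrow> z \<in> cball 0 R \<Longrightarrow> norm (v y s - v z s) \<le> L * norm (y - z)"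
proof -
  have "\<exists>B. \<forall>y\<in>cball 0 R. \<forall>s\<in>K. norm (Dv y s b) \<le> B" for b
  proof -
    have "compact ((\<lambda>(y, s). Dv y s b) ` (cball 0 R \<times> K))"
      by (intro compact_continuous_image continuous_on_subset[OF cont] compact_Times K) auto
    then obtain B where "\<forall>z\<in>(\<lambda>(y, s). Dv y s b) ` (cball 0 R \<times> K). norm z \<le> B"
      using compact_imp_bounded bounded_iff by blast
    then show ?thesis by fastforce
  qed
  then obtain B where B: "\<And>b y s. y \<in> cball 0 R \<Longrightarrow> s \<in> K \<Longrightarrow> norm (Dv y s b) \<le> B b"
    by metis
  \<comment> \<open>A bound \<open>B b\<close> may be negative when the ball or \<open>K\<close> is
    empty, hence \<open>max 0\<close>.\<close>
  define L where "L = (\<Sum>b\<in>Basis. max 0 (B b))"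
  have on: "onorm (Dv y s) \<le> L" if "y \<in> cball 0 R" "s \<in> K" for y s
  proof (rule onorm_bound)
    show "0 \<le> L" by (simp add: L_def sum_nonneg)
    fix w
    have "Dv y s w = (\<Sum>b\<in>Basis. (w \<bullet> b) *\<^sub>R Dv y s b)"
      by (rule linear_expand[OF has_derivative_linear[OF Dv[OF that(2)]]])
    also have "norm \<dots> \<le> (\<Sum>b\<in>Basis. norm w * max 0 (B b))"
      using B[OF that] by (intro sum_norm_le) (auto intro!: mult_mono Basis_le_norm simp: le_max_iff_disj)
    finally show "norm (Dv y s w) \<le> L * norm w"
      by (simp add: L_def sum_distrib_left mult.commute)
  qed
  show ?thesis
  proof
    show "0 \<le> L" by (simp add: L_def sum_nonneg)
    show "norm (v y s - v z s) \<le> L * norm (y - z)"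
      if "s \<in> K" "y \<in> cball 0 R" "z \<in> cball 0 R" for s y z
      using that on by (intro differentiable_bound[of "cball 0 R" _ "\<lambda>y. Dv y s"])
        (auto intro: has_derivative_at_withinI Dv)
  qed
qed

text \<open>Joint smoothness of the flow is not assumed. Pointwise differentiability at each time suffices:
  the difference quotients satisfy an integral equation with uniformly bounded integrand, and
  dominated convergence passes to the limit.\<close>

lemma variational_equation:
  fixes v :: "'a::euclidean_space \<Rightarrow> real \<Rightarrow> 'a"
  assumes Dv: "\<And>y s. s \<in> {0..\<tau>} \<Longrightarrow> ((\<lambda>y. v y s) has_derivative Dv y s) (at y)"
    and cont: "\<And>h. continuous_on (UNIV \<times> {0..\<tau>}) (\<lambda>(y, s). Dv y s h)"
    and X0: "\<And>b. X b 0 = b"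
    and X: "\<And>b s. s \<in> {0..\<tau>} \<Longrightarrow> (X b has_vector_derivative v (X b s) s) (at s within {0..\<tau>})"
    and F: "\<And>s. s \<in> {0..\<tau>} \<Longrightarrow> ((\<lambda>b. X b s) has_derivative F s) (at a)"
    and s: "s \<in> {0..\<tau>}"
  shows "((\<lambda>s. F s e) has_vector_derivative Dv (X a s) s (F s e)) (at s within {0..\<tau>})"
proof -
  have contX: "continuous_on {0..\<tau>} (X b)" for b
    unfolding continuous_on_eq_continuous_within using X has_vector_derivative_continuous by blast
  obtain R where R: "\<And>s. s \<in> {0..\<tau>} \<Longrightarrow> norm (X a s) \<le> R"
    using compact_imp_bounded[OF compact_continuous_image[OF contX[of a] compact_Icc]]
    unfolding bounded_iff by (metis imageI)
  \<comment> \<open>The ball of radius \<open>R + 1\<close> contains the unit tube around the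
    trajectory \<open>X a\<close>.\<close>
  obtain L where L: "L \<ge> 0" and lipR: "\<And>s y z. s \<in> {0..\<tau>} \<Longrightarrow> y \<in> cball 0 (R + 1) \<Longrightarrow> z \<in> cball 0 (R + 1) \<Longrightarrow>
      norm (v y s - v z s) \<le> L * norm (y - z)"
    using uniformly_lipschitz_on_cball[OF Dv cont compact_Icc] by blast
  have lip: "norm (v y s - v (X a s) s) \<le> L * norm (y - X a s)"
    if "s \<in> {0..\<tau>}" "norm (y - X a s) \<le> 1" for s y
    using that R[of s] norm_triangle_sub[of y "X a s"] by (intro lipR) auto
  \<comment> \<open>Chosen so that an initial displacement of size at most \<open>c * norm e\<close>
    keeps the perturbed trajectory in the unit tube up to time \<open>\<tau>\<close>; the summand 1
    makes this strict and covers \<open>e = 0\<close>.\<close>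
  define c where "c = 1 / ((norm e + 1) * exp (L * \<tau>))"
  define h where "h n = c / real (Suc n)" for n
  have "norm e + 1 > 0" by (simp add: add_nonneg_pos)
  then have c: "c > 0" by (simp add: c_def)
  have hc: "h n \<le> c" for n
    using c by (simp add: h_def divide_le_eq)
  have hpos: "h n > 0" for n
    using c by (simp add: h_def)
  then have hne: "h n \<noteq> 0" for n
    by (metis less_irrefl)
  have h0: "h \<longlonglongrightarrow> 0"
    unfolding h_def by (rule LIMSEQ_Suc[OF lim_const_over_n])
  have small: "norm (X (a + h n *\<^sub>R e) 0 - X a 0) * exp (L * \<tau>) < 1" for n
  proof -
    have "norm (X (a + h n *\<^sub>R e) 0 - X a 0) * exp (L * \<tau>) \<le> c * norm e * exp (L * \<tau>)"
      using hpos[of n] hc[of n] by (simp add: X0 mult_right_mono)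
    also have "\<dots> = norm e / (norm e + 1)"
      by (simp add: c_def)
    also have "\<dots> < 1"
      using \<open>norm e + 1 > 0\<close> by simp
    finally show ?thesis .
  qed
  have close: "norm (X (a + h n *\<^sub>R e) s - X a s) < 1"
    "norm (X (a + h n *\<^sub>R e) s - X a s) \<le> norm (X (a + h n *\<^sub>R e) 0 - X a 0) * exp (L * \<tau>)"
    if "s \<in> {0..\<tau>}" for n s
    using that trajectories_close[of \<tau> "X (a + h n *\<^sub>R e)" v "X a" L s] X lip L small by blast+
  define Y where "Y n s = (X (a + h n *\<^sub>R e) s - X a s) /\<^sub>R h n" for n s
  define Y' where "Y' n s = (v (X (a + h n *\<^sub>R e) s) s - v (X a s) s) /\<^sub>R h n" for n s
  define G where "G s = Dv (X a s) s (F s e)" for s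
  have dY: "(Y n has_vector_derivative Y' n s) (at s within {0..\<tau>})" if "s \<in> {0..\<tau>}" for n s
    unfolding Y_def Y'_def using X[OF that]
    by (intro bounded_linear.has_vector_derivative[OF bounded_linear_scaleR_right] derivative_intros)
  have Ylim: "(\<lambda>n. Y n s) \<longlonglongrightarrow> F s e" if "s \<in> {0..\<tau>}" for s
    unfolding Y_def by (rule difference_quotient_tendsto[OF F[OF that] h0 hne])
  have Y'lim: "(\<lambda>n. Y' n s) \<longlonglongrightarrow> G s" if "s \<in> {0..\<tau>}" for s
    unfolding Y'_def G_def
    by (rule difference_quotient_tendsto[OF has_derivative_compose[OF F[OF that] Dv[OF that]] h0 hne])
  have Y'bound: "norm (Y' n s) \<le> L * (norm e * exp (L * \<tau>))" if "s \<in> {0..\<tau>}" for n s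
  proof -
    have "norm (v (X (a + h n *\<^sub>R e) s) s - v (X a s) s) \<le> L * norm (X (a + h n *\<^sub>R e) s - X a s)"
      using close(1)[OF that, of n] by (intro lip[OF that]) simp
    also have "\<dots> \<le> L * (norm (X (a + h n *\<^sub>R e) 0 - X a 0) * exp (L * \<tau>))"
      using close(2)[OF that, of n] L by (rule mult_left_mono)
    also have "\<dots> = h n * (L * (norm e * exp (L * \<tau>)))"
      using hpos[of n] by (simp add: X0)
    finally show ?thesis using hpos[of n] by (simp add: Y'_def inverse_eq_divide pos_divide_le_eq mult_ac)
  qed
  have int: "G integrable_on {0..r}" "F r e = e + integral {0..r} G" if r: "r \<in> {0..\<tau>}" for r
  proof -
    have ftc: "(Y' n has_integral Y n r - Y n 0) {0..r}" for n
      using r by (intro fundamental_theorem_of_calculus)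
        (auto intro: has_vector_derivative_within_subset[OF dY])
    have Y0: "Y n 0 = e" for n using hpos[of n] by (simp add: Y_def X0)
    have dom: "norm (Y' n s) \<le> L * (norm e * exp (L * \<tau>))" "(\<lambda>n. Y' n s) \<longlonglongrightarrow> G s"
      if "s \<in> {0..r}" for n s
      using that r Y'bound Y'lim by auto
    show "G integrable_on {0..r}"
      by (rule dominated_convergence(1)[OF has_integral_integrable[OF ftc] integrable_const_ivl dom])
    have "(\<lambda>n. integral {0..r} (Y' n)) \<longlonglongrightarrow> integral {0..r} G"
      by (rule dominated_convergence(2)[OF has_integral_integrable[OF ftc] integrable_const_ivl dom])
    moreover have "(\<lambda>n. integral {0..r} (Y' n)) \<longlonglongrightarrow> F r e - e"
      using tendsto_diff[OF Ylim[OF r] tendsto_const[of e]] by (simp add: integral_unique[OF ftc] Y0)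
    ultimately show "F r e = e + integral {0..r} G"
      using LIMSEQ_unique by (fastforce simp: algebra_simps)
  qed
  have "\<tau> \<in> {0..\<tau>}" using s by auto
  then have "continuous_on {0..\<tau>} (\<lambda>r. e + integral {0..r} G)"
    using int(1) by (intro continuous_intros indefinite_integral_continuous_1)
  then have contF: "continuous_on {0..\<tau>} (\<lambda>r. F r e)"
    by (rule continuous_on_eq) (simp only: int(2))
  \<comment> \<open>\<open>Dv\<close> is jointly continuous for a fixed direction, while
    \<open>G\<close> applies it to the moving vector \<open>F s e\<close>. Expanding that vector in
    the basis reduces continuity of \<open>G\<close> to this and to \<open>contF\<close>.\<close>
  have "continuous_on {0..\<tau>} (\<lambda>s. (\<lambda>(y, s). Dv y s b) (X a s, s))" for b
    by (rule continuous_on_compose2[OF cont]) (auto intro!: continuous_intros contX)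
  then have "continuous_on {0..\<tau>} (\<lambda>s. \<Sum>b\<in>Basis. (F s e \<bullet> b) *\<^sub>R Dv (X a s) s b)"
    using contF by (intro continuous_intros) auto
  then have "continuous_on {0..\<tau>} G"
    by (rule continuous_on_eq)
      (simp add: G_def linear_expand[OF has_derivative_linear[OF Dv], of _ _ "F _ e", symmetric])
  then have "((\<lambda>r. integral {0..r} G) has_vector_derivative G s) (at s within {0..\<tau>})"
    using s by (rule integral_has_vector_derivative)
  then have "((\<lambda>r. e + integral {0..r} G) has_vector_derivative G s) (at s within {0..\<tau>})"
    by (auto intro!: derivative_eq_intros)
  then show ?thesis
    unfolding G_def[symmetric] using int(2) s by (auto intro: has_vector_derivative_transform)
qed

text \<open>Liouville's formula in the plane: the determinant of two solutions has derivative equal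
  to the trace of \<open>B s\<close> times itself, hence zero.\<close>

lemma wronskian_const_of_trace_0:
  fixes B :: "real \<Rightarrow> real^2 \<Rightarrow> real^2" and f g :: "real \<Rightarrow> real^2"
  assumes lin: "\<And>s. s \<in> {0..\<tau>} \<Longrightarrow> linear (B s)"
    and trace: "\<And>s. s \<in> {0..\<tau>} \<Longrightarrow> B s (axis 1 1) $ 1 + B s (axis 2 1) $ 2 = 0"
    and f: "\<And>s. s \<in> {0..\<tau>} \<Longrightarrow> (f has_vector_derivative B s (f s)) (at s within {0..\<tau>})"
    and g: "\<And>s. s \<in> {0..\<tau>} \<Longrightarrow> (g has_vector_derivative B s (g s)) (at s within {0..\<tau>})"
    and s: "s \<in> {0..\<tau>}"
  shows "f s $ 1 * g s $ 2 - g s $ 1 * f s $ 2 = f 0 $ 1 * g 0 $ 2 - g 0 $ 1 * f 0 $ 2"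
proof -
  have "((\<lambda>s. f s $ 1 * g s $ 2 - g s $ 1 * f s $ 2) has_derivative (\<lambda>h. 0)) (at s within {0..\<tau>})"
    if s: "s \<in> {0..\<tau>}" for s
  proof -
    have expand: "B s w = w $ 1 *\<^sub>R B s (axis 1 1) + w $ 2 *\<^sub>R B s (axis 2 1)" for w
    proof -
      have "w = w $ 1 *\<^sub>R axis 1 1 + w $ 2 *\<^sub>R axis 2 1"
        by (simp add: vec_eq_iff forall_2 axis_def)
      then have "B s w = B s (w $ 1 *\<^sub>R axis 1 1 + w $ 2 *\<^sub>R axis 2 1)" by simp
      then show ?thesis by (simp only: linear_add[OF lin[OF s]] linear_scale[OF lin[OF s]])
    qed
    define p q r where "p = B s (axis 1 1) $ 1" and "q = B s (axis 2 1) $ 1" and "r = B s (axis 1 1) $ 2"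
    \<comment> \<open>Zero trace makes the lower right entry of \<open>B s\<close> equal to
      \<open>- p\<close>, so that the terms of the product rule cancel.\<close>
    have comp: "B s w $ 1 = w $ 1 * p + w $ 2 * q" "B s w $ 2 = w $ 1 * r - w $ 2 * p" for w
      using trace[OF s] by (simp_all add: expand[of w] p_def q_def r_def) algebra
    have nth: "((\<lambda>s. w s $ i) has_real_derivative B s (w s) $ i) (at s within {0..\<tau>})"
      if "(w has_vector_derivative B s (w s)) (at s within {0..\<tau>})" for w and i :: 2
      using bounded_linear.has_vector_derivative[OF bounded_linear_vec_nth that]
      by (simp add: has_real_derivative_iff_has_vector_derivative)
    have "((\<lambda>s. f s $ 1 * g s $ 2 - g s $ 1 * f s $ 2) has_real_derivative 0) (at s within {0..\<tau>})"
      by (auto intro!: derivative_eq_intros nth f g s simp: comp algebra_simps)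
    then show ?thesis by (simp add: has_field_derivative_def lambda_zero)
  qed
  then show ?thesis
    by (rule has_derivative_zero_unique[OF convex_real_interval(5)]) (use s in auto)
qed

section \<open>Spectral estimates\<close>

lemma inner_transpose_mult_self: "w \<bullet> ((transpose J ** J) *v w) = (norm (J *v w))\<^sup>2"
  for J :: "real^'n^'m"
proof -
  have "w \<bullet> ((transpose J ** J) *v w) = (w v* transpose J) \<bullet> (J *v w)"
    by (simp only: matrix_vector_mul_assoc[symmetric] dot_lmul_matrix)
  then show ?thesis
    by (simp add: vector_transpose_matrix dot_square_norm)
qed

text \<open>Two orthonormal vectors form a basis of the plane in which \<open>M\<close> acts
  diagonally; in coordinates this becomes a set of polynomial identities.\<close>

lemma ordered_eigensystem_diagonalizes:
  assumes "ordered_eigensystem M l1 l2 e1 e2"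
  shows "w \<bullet> (M *v w) = l1 * (w \<bullet> e1)\<^sup>2 + l2 * (w \<bullet> e2)\<^sup>2"
    and "(norm w)\<^sup>2 = (w \<bullet> e1)\<^sup>2 + (w \<bullet> e2)\<^sup>2"
    and "det M = l1 * l2"
proof -
  define a b c d where "a = e1 $ 1" and "b = e1 $ 2" and "c = e2 $ 1" and "d = e2 $ 2"
  note abcd = a_def[symmetric] b_def[symmetric] c_def[symmetric] d_def[symmetric]
  have M: "M *v e1 = l1 *\<^sub>R e1" "M *v e2 = l2 *\<^sub>R e2"
    and n: "e1 \<bullet> e1 = 1" "e2 \<bullet> e2 = 1" "e1 \<bullet> e2 = 0"
    using assms by (auto simp: ordered_eigensystem_def dot_square_norm)
  have n': "a * a + b * b = 1" "c * c + d * d = 1" "a * c + b * d = 0"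
    using n by (simp_all add: inner_vec_def sum_2 abcd)
  have D: "(a * d - b * c)\<^sup>2 = 1"
    using n' by algebra
  have D0: "a * d - b * c \<noteq> 0" using D by auto
  have expand: "w = (w \<bullet> e1) *\<^sub>R e1 + (w \<bullet> e2) *\<^sub>R e2" for w
  proof -
    \<comment> \<open>The matrix with rows \<open>e1\<close> and \<open>e2\<close> is orthogonal, so
      its columns are orthonormal too; this is the completeness that the expansion needs.\<close>
    have "a * a + c * c = 1" "b * b + d * d = 1" "a * b + c * d = 0"
      using n' D by algebra+
    then show ?thesis
      by (simp add: vec_eq_iff forall_2 inner_vec_def sum_2 abcd) algebra
  qed
  have Mw: "M *v w = (w \<bullet> e1) *\<^sub>R l1 *\<^sub>R e1 + (w \<bullet> e2) *\<^sub>R l2 *\<^sub>R e2"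
    by (subst (1) expand) (simp only: matrix_vector_right_distrib matrix_vector_mult_scaleR M)
  show "w \<bullet> (M *v w) = l1 * (w \<bullet> e1)\<^sup>2 + l2 * (w \<bullet> e2)\<^sup>2"
    by (simp add: Mw inner_add_right power2_eq_square)
  show "(norm w)\<^sup>2 = (w \<bullet> e1)\<^sup>2 + (w \<bullet> e2)\<^sup>2"
    unfolding dot_square_norm[symmetric]
    by (subst (2) expand) (simp add: inner_add_right power2_eq_square)
  have "M $ 1 $ 1 * a + M $ 1 $ 2 * b = l1 * a" "M $ 2 $ 1 * a + M $ 2 $ 2 * b = l1 * b"
    "M $ 1 $ 1 * c + M $ 1 $ 2 * d = l2 * c" "M $ 2 $ 1 * c + M $ 2 $ 2 * d = l2 * d"
    using M by (simp_all add: vec_eq_iff forall_2 matrix_vector_mult_def sum_2 abcd)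
  then have "det M * (a * d - b * c) = l1 * l2 * (a * d - b * c)"
    unfolding det_2 by algebra
  then show "det M = l1 * l2" using D0 by simp
qed

text \<open>A matrix and its transpose have the same operator norm. Diagonalization bounds that of
  \<open>J\<close> by \<open>sqrt l1\<close>; for \<open>w = transpose J *v g\<close>, the square of
  \<open>norm w\<close> is the inner product of \<open>g\<close> with \<open>J *v w\<close>, and one
  factor \<open>norm w\<close> cancels.\<close>

lemma norm_transpose_mult_le:
  assumes es: "ordered_eigensystem (transpose J ** J) l1 l2 e1 e2"
  shows "norm (transpose J *v g) \<le> sqrt l1 * norm g"
proof -
  define w where "w = transpose J *v g"
  have "(norm (J *v w))\<^sup>2 \<le> l1 * (norm w)\<^sup>2"
    using es unfolding inner_transpose_mult_self[symmetric] ordered_eigensystem_diagonalizes(1,2)[OF es]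
    by (simp add: ordered_eigensystem_def distrib_left mult_right_mono)
  then have Jw: "norm (J *v w) \<le> sqrt l1 * norm w"
    by (metis abs_of_nonneg norm_ge_zero real_le_rsqrt real_sqrt_abs real_sqrt_mult)
  have "norm w * norm w = g \<bullet> (J *v w)"
    unfolding power2_eq_square[symmetric] dot_square_norm[symmetric]
    by (simp add: w_def dot_lmul_matrix[symmetric])
  also have "\<dots> \<le> norm g * norm (J *v w)" by (rule norm_cauchy_schwarz)
  also have "\<dots> \<le> norm g * (sqrt l1 * norm w)" using Jw by (intro mult_left_mono) auto
  finally have "norm w * norm w \<le> (sqrt l1 * norm g) * norm w" by (simp add: mult_ac)
  then show ?thesis
    unfolding w_def[symmetric]
    using es by (cases "norm w = 0") (auto simp: ordered_eigensystem_def mult_le_cancel_right)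
qed

definition perp :: "real^2 \<Rightarrow> real^2" where
  "perp g = vector [- (g $ 2), g $ 1]"

lemma norm_perp [simp]: "norm (perp g) = norm g"
  by (simp add: perp_def norm_vec_def L2_set_def sum_2 add.commute)

text \<open>If \<open>R\<close> is the matrix of the quarter turn \<open>perp\<close>, then
  \<open>J ** R ** transpose J\<close> is skew-symmetric, hence in the plane a multiple of
  \<open>R\<close>; the factor is \<open>det J\<close>.\<close>

lemma mult_perp_transpose: "J *v perp (transpose J *v g) = det J *\<^sub>R perp g"
  for J :: "real^2^2"
  by (simp add: perp_def vec_eq_iff forall_2 matrix_vector_mult_def sum_2 det_2 transpose_def algebra_simps)

text \<open>With c the absolute value of the inner product of \<open>u\<close> and
  \<open>e2\<close>, the left side is 2 - 2c by the choice of sign and the right side is 2 - 2c^2 by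
  orthonormality, where 0 \<le> c \<le> 1.\<close>

lemma norm_diff_oriented_along_le:
  assumes es: "ordered_eigensystem M l1 l2 e1 e2" and u: "norm u = 1"
  shows "(norm (u - oriented_along u e2))\<^sup>2 \<le> 2 * (u \<bullet> e1)\<^sup>2"
proof -
  have n2: "norm e2 = 1" using es by (simp add: ordered_eigensystem_def)
  have "(norm (u - oriented_along u e2))\<^sup>2 = 2 - 2 * \<bar>u \<bullet> e2\<bar>"
    using u n2 by (auto simp: oriented_along_def inner_commute algebra_simps norm_eq_1
        simp flip: dot_square_norm)
  moreover have "(u \<bullet> e1)\<^sup>2 = 1 - \<bar>u \<bullet> e2\<bar> * \<bar>u \<bullet> e2\<bar>"
    using ordered_eigensystem_diagonalizes(2)[OF es, of u] u by (simp add: power2_eq_square)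
  moreover have "\<bar>u \<bullet> e2\<bar> \<le> 1"
    using Cauchy_Schwarz_ineq2[of u e2] u n2 by simp
  then have "\<bar>u \<bullet> e2\<bar> * \<bar>u \<bullet> e2\<bar> \<le> \<bar>u \<bullet> e2\<bar>"
    by (rule mult_left_le) simp
  ultimately show ?thesis by linarith
qed

section \<open>Transport and incompressibility\<close>

lemma time_interval_subset: "t \<in> time_interval T \<Longrightarrow> {0..t} \<subseteq> time_interval T"
  by (auto simp: time_interval_def intro: le_less_trans[of "ereal _" "ereal t"])

lemma convex_time_interval: "convex (time_interval T)"
proof -
  have "is_interval (time_interval T)"
    by (auto simp: is_interval_1 time_interval_def intro: le_less_trans[of "ereal _" "ereal _"])
  then show ?thesis by (simp add: is_interval_convex_1)
qed

text \<open>The upper bound \<open>T\<close> is strict, so an interval to the right of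
  \<open>t\<close> lies in the domain. This makes time derivatives within the domain unique, also at
  time 0.\<close>

lemma at_within_time_interval_neq_bot:
  assumes "t \<in> time_interval T"
  shows "at t within time_interval T \<noteq> bot"
proof -
  obtain q where q: "t < q" "ereal q < T"
    using assms ereal_dense2[of "ereal t" T] by (auto simp: time_interval_def)
  then have "{t..q} \<subseteq> time_interval T"
    using assms by (auto simp: time_interval_def intro: le_less_trans[of "ereal _" "ereal q"])
  then have "at_right t \<le> at t within time_interval T"
    using at_le q(1) by (metis at_within_Icc_at_right)
  then show ?thesis
    using trivial_limit_at_right_real[of t] bot_unique by metis
qed

lemma smooth_on_imp_has_derivative:
  assumes "smooth_on S f" "z \<in> S"
  shows "(f has_derivative frechet_derivative f (at z within S)) (at z within S)"
proof -
  have "Ck_on (Suc 0) S f" using assms(1) unfolding smooth_on_def by blast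
  then show ?thesis using assms(2) by (simp add: differentiable_on_def frechet_derivative_works)
qed

lemma smooth_on_imp_continuous_derivative:
  assumes "smooth_on S f"
  shows "continuous_on S (\<lambda>z. frechet_derivative f (at z within S) h)"
proof -
  have "Ck_on (Suc 0) S f" using assms(1) unfolding smooth_on_def by blast
  then show ?thesis by simp
qed

text \<open>A slice at fixed time stays in the slab in all spatial directions, so the spatial
  derivative is a full one even at a boundary time.\<close>

lemma has_derivative_slice_fst:
  assumes "((\<lambda>(x, t). f x t) has_derivative D) (at (y, s) within UNIV \<times> I)" "s \<in> I"
  shows "((\<lambda>x. f x s) has_derivative (\<lambda>h. D (h, 0))) (at y)"
proof -
  have "((\<lambda>x. (x, s)) has_derivative (\<lambda>h. (h, 0))) (at y)"
    by (auto intro!: derivative_eq_intros)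
  moreover have "((\<lambda>(x, t). f x t) has_derivative D) (at (y, s) within range (\<lambda>x. (x, s)))"
    by (rule has_derivative_subset[OF assms(1)]) (use assms(2) in auto)
  ultimately show ?thesis
    using has_derivative_in_compose[of "\<lambda>x. (x, s)" _ y UNIV "\<lambda>(x, t). f x t" D] by simp
qed

text \<open>Chain rule along the space-time curve \<open>(c t, t)\<close>, whose time component has
  speed 1; a constant \<open>c\<close> yields the partial time derivative.\<close>

lemma has_vector_derivative_along_curve:
  assumes "((\<lambda>(x, t). f x t) has_derivative D) (at (c s, s) within UNIV \<times> I)"
    and "(c has_vector_derivative w) (at s within I)"
  shows "((\<lambda>t. f (c t) t) has_vector_derivative D (w, 1)) (at s within I)"
proof -
  have "((\<lambda>t. (c t, t)) has_derivative (\<lambda>h. (h *\<^sub>R w, h))) (at s within I)"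
    using assms(2) unfolding has_vector_derivative_def by (auto intro!: derivative_eq_intros)
  moreover have "((\<lambda>(x, t). f x t) has_derivative D) (at (c s, s) within (\<lambda>t. (c t, t)) ` I)"
    by (rule has_derivative_subset[OF assms(1)]) auto
  ultimately have "((\<lambda>t. f (c t) t) has_derivative (\<lambda>h. D (h *\<^sub>R w, h))) (at s within I)"
    using has_derivative_in_compose[of "\<lambda>t. (c t, t)" _ s I "\<lambda>(x, t). f x t" D] by simp
  moreover have "D (h *\<^sub>R w, h) = h *\<^sub>R D (w, 1)" for h
    using linear_scale[OF has_derivative_linear[OF assms(1)], of h "(w, 1)"] by simp
  ultimately show ?thesis by (simp add: has_vector_derivative_def)
qed

lemma grad_inner:
  assumes "(f has_derivative f') (at x)"
  shows "f' h = grad f x \<bullet> h"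
proof -
  have "h = h $ 1 *\<^sub>R axis 1 1 + h $ 2 *\<^sub>R axis 2 1"
    by (simp add: vec_eq_iff forall_2 axis_def)
  then have "f' h = f' (h $ 1 *\<^sub>R axis 1 1 + h $ 2 *\<^sub>R axis 2 1)" by simp
  also have "\<dots> = grad f x \<bullet> h"
    using has_derivative_linear[OF assms] frechet_derivative_at[OF assms]
    by (simp add: linear_add linear_scale grad_def inner_vec_def sum_2)
  finally show ?thesis .
qed

text \<open>The total time derivative of \<open>\<theta>\<close> along a trajectory splits into the
  advection term and the partial time derivative, whose sum vanishes by the equation.\<close>

lemma transported_along_trajectories:
  assumes sol: "smooth_sqg_solution T \<theta>0 v \<theta>" and X: "particle_trajectory_map T v X"
    and t: "t \<in> time_interval T"
  shows "\<theta> (X a t) t = \<theta>0 a"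
proof -
  define I where "I = time_interval T"
  define D where "D z = frechet_derivative (\<lambda>(x, t). \<theta> x t) (at z within UNIV \<times> I)" for z
  have D: "((\<lambda>(x, t). \<theta> x t) has_derivative D (y, s)) (at (y, s) within UNIV \<times> I)" if "s \<in> I" for y s
    using sol that unfolding D_def smooth_sqg_solution_def I_def
    by (intro smooth_on_imp_has_derivative) auto
  have eq: "vector_derivative (\<theta> y) (at s within I) + v y s \<bullet> grad (\<lambda>y. \<theta> y s) y = 0" if "s \<in> I" for y s
    using sol that unfolding smooth_sqg_solution_def I_def by blast
  have "((\<lambda>s. \<theta> (X a s) s) has_derivative (\<lambda>h. 0)) (at s within I)" if s: "s \<in> I" for s
  proof -
    let ?y = "X a s"
    have "(X a has_vector_derivative v ?y s) (at s within I)"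
      using X s unfolding particle_trajectory_map_def I_def by blast
    with D[OF s] have "((\<lambda>s. \<theta> (X a s) s) has_vector_derivative D (?y, s) (v ?y s, 1)) (at s within I)"
      by (rule has_vector_derivative_along_curve)
    moreover have "D (?y, s) (v ?y s, 1) = D (?y, s) (v ?y s, 0) + D (?y, s) (0, 1)"
      using linear_add[OF has_derivative_linear[OF D[OF s]], of ?y "(v ?y s, 0)" "(0, 1)"] by simp
    moreover have "D (?y, s) (v ?y s, 0) = v ?y s \<bullet> grad (\<lambda>y. \<theta> y s) ?y"
      using grad_inner[OF has_derivative_slice_fst[OF D[OF s] s]] by (simp add: inner_commute)
    moreover have "(\<theta> ?y has_vector_derivative D (?y, s) (0, 1)) (at s within I)"
      by (rule has_vector_derivative_along_curve[OF D[OF s]]) simp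
    then have "D (?y, s) (0, 1) = vector_derivative (\<theta> ?y) (at s within I)"
      using vector_derivative_within at_within_time_interval_neq_bot s unfolding I_def by metis
    ultimately show ?thesis
      using eq[OF s, of ?y] by (simp add: has_vector_derivative_def add.commute)
  qed
  note const = this
  have "convex I" "t \<in> I" "0 \<in> I"
    using t convex_time_interval time_interval_subset[OF t] by (auto simp: I_def time_interval_def)
  then have "\<theta> (X a t) t = \<theta> (X a 0) 0"
    by (intro has_derivative_zero_unique[of I "\<lambda>s. \<theta> (X a s) s"] const)
  then show ?thesis
    using sol X by (simp add: smooth_sqg_solution_def particle_trajectory_map_def)
qed

text \<open>The columns of the Jacobian of the flow solve the variational equation, whose
  coefficient matrix is the velocity gradient and has trace zero. Their determinant therefore keeps
  its initial value 1, and the Jacobian of \<open>A\<close> is the inverse matrix.\<close>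

lemma det_spatial_jacobian_eq_1:
  assumes sol: "smooth_sqg_solution T \<theta>0 v \<theta>" and X: "particle_trajectory_map T v X"
    and A: "back_to_label_map T X A" and t: "t \<in> time_interval T"
  shows "det (spatial_jacobian A x t) = 1"
proof -
  define I where "I = time_interval T"
  have sub: "s \<in> I" if "s \<in> {0..t}" for s
    using that time_interval_subset[OF t] by (auto simp: I_def)
  have t0: "t \<in> {0..t}" "0 \<in> {0..t}" using t by (auto simp: time_interval_def)
  define D where "D z = frechet_derivative (\<lambda>(x, t). v x t) (at z within UNIV \<times> I)" for z
  have sm: "smooth_on (UNIV \<times> I) (\<lambda>(x, t). v x t)"
    using sol unfolding smooth_sqg_solution_def I_def by blast
  define Dv where "Dv y s h = D (y, s) (h, 0)" for y s h
  have Dv: "((\<lambda>y. v y s) has_derivative Dv y s) (at y)" if "s \<in> I" for y s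
  proof -
    have "((\<lambda>(x, t). v x t) has_derivative D (y, s)) (at (y, s) within UNIV \<times> I)"
      unfolding D_def using sm that by (intro smooth_on_imp_has_derivative) auto
    from has_derivative_slice_fst[OF this that] show ?thesis by (simp add: Dv_def[abs_def])
  qed
  have cont: "continuous_on (UNIV \<times> I) (\<lambda>(y, s). Dv y s h)" for h
    using smooth_on_imp_continuous_derivative[OF sm, of "(h, 0)"]
    by (simp add: Dv_def D_def case_prod_unfold)
  have div: "Dv y s (axis 1 1) $ 1 + Dv y s (axis 2 1) $ 2 = 0" if s: "s \<in> I" for y s
  proof -
    obtain \<psi> where "\<psi> differentiable_on UNIV" "\<And>x. v x s = - perp_grad \<psi> x"
      using sol s unfolding smooth_sqg_solution_def I_def by blast
    moreover have "continuous_on UNIV (\<lambda>y. (\<lambda>(y, s). Dv y s h) (y, s))" for h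
      by (rule continuous_on_compose2[OF cont]) (auto intro!: continuous_intros s)
    ultimately show ?thesis
      using divergence_perp_grad_eq_0[of \<psi> "\<lambda>y. v y s" "\<lambda>y. Dv y s"] Dv[OF s] by simp
  qed
  \<comment> \<open>The label of the particle that is at \<open>x\<close> at time \<open>t\<close>;
    the flow is linearized at this label.\<close>
  define a where "a = A x t"
  define F where "F s = frechet_derivative (\<lambda>b. X b s) (at a)" for s
  have diffeo: "diffeomorphism_with_inverse (\<lambda>a. X a s) (\<lambda>x. A x s)" if "s \<in> I" for s
    using A that unfolding back_to_label_map_def I_def by blast
  have F: "((\<lambda>b. X b s) has_derivative F s) (at a)" if "s \<in> I" for s
    unfolding F_def using diffeo[OF that] unfolding diffeomorphism_with_inverse_def
    by (intro smooth_on_imp_has_derivative) auto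
  have X0: "X b 0 = b" for b
    using X unfolding particle_trajectory_map_def by blast
  have F0: "F 0 e = e" for e
    unfolding F_def X0 by simp
  have dX: "(X b has_vector_derivative v (X b s) s) (at s within {0..t})" if "s \<in> {0..t}" for b s
    using X sub[OF that] time_interval_subset[OF t]
    unfolding particle_trajectory_map_def I_def by (blast intro: has_vector_derivative_within_subset)
  have var: "((\<lambda>s. F s e) has_vector_derivative Dv (X a s) s (F s e)) (at s within {0..t})"
    if "s \<in> {0..t}" for s e
  proof (rule variational_equation[OF _ _ X0 dX _ that])
    show "((\<lambda>y. v y s) has_derivative Dv y s) (at y)" if "s \<in> {0..t}" for y s
      using Dv sub that by blast
    show "continuous_on (UNIV \<times> {0..t}) (\<lambda>(y, s). Dv y s h)" for h
      using sub by (intro continuous_on_subset[OF cont]) auto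
    show "((\<lambda>b. X b s) has_derivative F s) (at a)" if "s \<in> {0..t}" for s
      using F sub that by blast
  qed
  have "F t (axis 1 1) $ 1 * F t (axis 2 1) $ 2 - F t (axis 2 1) $ 1 * F t (axis 1 1) $ 2 =
      F 0 (axis 1 1) $ 1 * F 0 (axis 2 1) $ 2 - F 0 (axis 2 1) $ 1 * F 0 (axis 1 1) $ 2"
    by (rule wronskian_const_of_trace_0[where B = "\<lambda>s. Dv (X a s) s", OF _ _ var var t0(1)])
      (use div sub has_derivative_linear[OF Dv] in auto)
  then have detF: "det (matrix (F t)) = 1"
    by (simp add: det_2 matrix_def F0 axis_def mult.commute)
  have tI: "t \<in> I" using t by (simp add: I_def)
  have inv: "A (X b t) t = b" "X (A y t) t = y" for b y
    using diffeo[OF tI] by (auto simp: diffeomorphism_with_inverse_def)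
  have "(\<lambda>x. A x t) differentiable (at x)"
    using smooth_on_imp_has_derivative[of UNIV "\<lambda>x. A x t" x] diffeo[OF tI]
    by (auto simp: diffeomorphism_with_inverse_def differentiable_def)
  then have "((\<lambda>x. A x t) has_derivative (*v) (spatial_jacobian A x t)) (at (X a t))"
    by (simp add: jacobian_works spatial_jacobian_def a_def inv)
  \<comment> \<open>Differentiating \<open>A (X b t) t = b\<close> in \<open>b\<close> at
    \<open>a\<close> makes the two Jacobians inverse to each other.\<close>
  from has_derivative_compose[OF F[OF tI] this]
  have "((\<lambda>b. b) has_derivative (\<lambda>h. spatial_jacobian A x t *v F t h)) (at a)"
    by (simp add: inv)
  then have "(\<lambda>h. spatial_jacobian A x t *v F t h) = (\<lambda>h. h)"
    using has_derivative_ident has_derivative_unique by blast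
  then have "spatial_jacobian A x t *v (matrix (F t) *v h) = mat 1 *v h" for h
    using has_derivative_linear[OF F[OF tI]] by (simp add: fun_eq_iff)
  then have "spatial_jacobian A x t ** matrix (F t) = mat 1"
    unfolding matrix_eq by (simp add: matrix_vector_mul_assoc)
  then have "det (spatial_jacobian A x t) * det (matrix (F t)) = 1"
    by (simp flip: det_mul)
  then show ?thesis by (simp add: detF)
qed

text \<open>Transport gives \<open>\<theta> y t = \<theta>0 (A y t)\<close>, and the chain rule
  transposes the Jacobian when it is moved across the inner product. Differentiability of
  \<open>\<theta>0\<close> comes from the slice of \<open>\<theta>\<close> at time 0.\<close>

lemma grad_back_to_label:
  assumes sol: "smooth_sqg_solution T \<theta>0 v \<theta>" and X: "particle_trajectory_map T v X"
    and A: "back_to_label_map T X A" and t: "t \<in> time_interval T"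
  shows "grad (\<lambda>y. \<theta> y t) x = transpose (spatial_jacobian A x t) *v grad \<theta>0 (A x t)"
proof -
  have diffeo: "diffeomorphism_with_inverse (\<lambda>a. X a t) (\<lambda>x. A x t)"
    using A t unfolding back_to_label_map_def by blast
  have eq: "\<theta> y t = \<theta>0 (A y t)" for y
    using transported_along_trajectories[OF sol X t, of "A y t"] diffeo
    by (simp add: diffeomorphism_with_inverse_def)
  have "0 \<in> time_interval T"
    using time_interval_subset[OF t] t by (auto simp: time_interval_def)
  then have "((\<lambda>y. \<theta> y 0) has_derivative
      (\<lambda>h. frechet_derivative (\<lambda>(x, t). \<theta> x t) (at (A x t, 0) within UNIV \<times> time_interval T) (h, 0))) (at (A x t))"
    using sol unfolding smooth_sqg_solution_def
    by (intro has_derivative_slice_fst[of _ _ _ _ "time_interval T"] smooth_on_imp_has_derivative) auto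
  moreover have "(\<lambda>y. \<theta> y 0) = \<theta>0"
    using sol unfolding smooth_sqg_solution_def by blast
  ultimately obtain D0 where D0: "(\<theta>0 has_derivative D0) (at (A x t))" by auto
  have "(\<lambda>x. A x t) differentiable (at x)"
    using smooth_on_imp_has_derivative[of UNIV "\<lambda>x. A x t" x] diffeo
    by (auto simp: diffeomorphism_with_inverse_def differentiable_def)
  then have "((\<lambda>x. A x t) has_derivative (*v) (spatial_jacobian A x t)) (at x)"
    by (simp add: jacobian_works spatial_jacobian_def)
  from has_derivative_compose[OF this D0]
  have "((\<lambda>y. \<theta> y t) has_derivative (\<lambda>h. D0 (spatial_jacobian A x t *v h))) (at x)"
    by (simp add: eq)
  from grad_inner[OF this]
  have "grad (\<lambda>y. \<theta> y t) x \<bullet> h = grad \<theta>0 (A x t) \<bullet> (spatial_jacobian A x t *v h)" for h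
    using grad_inner[OF D0] by simp
  then have "grad (\<lambda>y. \<theta> y t) x \<bullet> h = (transpose (spatial_jacobian A x t) *v grad \<theta>0 (A x t)) \<bullet> h" for h
    by (simp add: dot_lmul_matrix[symmetric])
  then show ?thesis by (rule vector_eq_rdot[THEN iffD1, OF allI])
qed

section \<open>Eigenvalues and direction field along the blow-up sequence\<close>

lemma perp_grad_eq_perp: "perp_grad f x = perp (grad f x)"
  by (simp add: perp_grad_def perp_def)

theorem theorem2p1:
  fixes T :: ereal
    and \<theta>0 :: "real^2 \<Rightarrow> real"
    and \<theta> :: "real^2 \<Rightarrow> real \<Rightarrow> real"
    and v X A e1 e2 :: "real^2 \<Rightarrow> real \<Rightarrow> real^2"
    and l1 l2 :: "real^2 \<Rightarrow> real \<Rightarrow> real"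
    and x :: "nat \<Rightarrow> real^2" and t :: "nat \<Rightarrow> real"
    and xbar :: "real^2" and tbar :: ereal
  assumes "0 < T"
    and "smooth_sqg_solution T \<theta>0 v \<theta>"
    and "bounded (range (grad \<theta>0))"
    and "particle_trajectory_map T v X"
    and "back_to_label_map T X A"
    and "\<And>y s. s \<in> time_interval T \<Longrightarrow>
           ordered_eigensystem (deformation_matrix A y s) (l1 y s) (l2 y s) (e1 y s) (e2 y s)"
    and "\<And>k. t k \<in> time_interval T"
    and "x \<longlonglongrightarrow> xbar"
    and "(\<lambda>k. ereal (t k)) \<longlonglongrightarrow> tbar"
    and "filterlim (\<lambda>k. norm (grad (\<lambda>y. \<theta> y (t k)) (x k))) at_top sequentially"
  shows "filterlim (\<lambda>k. l1 (x k) (t k)) at_top sequentially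
    \<and> (\<lambda>k. l2 (x k) (t k)) \<longlonglongrightarrow> 0
    \<and> (\<lambda>k. norm (direction_field \<theta> (x k) (t k)
          - oriented_along (direction_field \<theta> (x k) (t k)) (e2 (x k) (t k)))) \<longlonglongrightarrow> 0"
proof -
  define J where "J k = spatial_jacobian A (x k) (t k)" for k
  define g where "g k = grad (\<lambda>y. \<theta> y (t k)) (x k)" for k
  define g0 where "g0 k = grad \<theta>0 (A (x k) (t k))" for k
  define a1 a2 f1 f2 where "a1 k = l1 (x k) (t k)" and "a2 k = l2 (x k) (t k)"
    and "f1 k = e1 (x k) (t k)" and "f2 k = e2 (x k) (t k)" for k
  define u where "u k = direction_field \<theta> (x k) (t k)" for k
  have es: "ordered_eigensystem (transpose (J k) ** J k) (a1 k) (a2 k) (f1 k) (f2 k)" for k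
    using assms(6)[OF assms(7)] by (simp add: J_def a1_def a2_def f1_def f2_def deformation_matrix_def)
  have detJ: "det (J k) = 1" for k
    unfolding J_def by (rule det_spatial_jacobian_eq_1[OF assms(2,4,5,7)])
  have g: "g k = transpose (J k) *v g0 k" for k
    unfolding g_def J_def g0_def by (rule grad_back_to_label[OF assms(2,4,5,7)])
  obtain C where C: "C > 0" "\<And>k. norm (g0 k) \<le> C"
    using assms(3) unfolding bounded_pos g0_def by auto
  have lim: "filterlim (\<lambda>k. norm (g k)) at_top sequentially"
    using assms(10) by (simp add: g_def)
  have prod: "a1 k * a2 k = 1" and ord: "a1 k \<ge> a2 k" "a2 k > 0" for k
    using ordered_eigensystem_diagonalizes(3)[OF es[of k]] es[of k] detJ[of k]
    by (auto simp: det_mul ordered_eigensystem_def)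
  \<comment> \<open>Of two positive numbers with product 1, the larger is at least 1.\<close>
  have a1: "a1 k \<ge> 1" for k
  proof (rule ccontr)
    assume "\<not> a1 k \<ge> 1"
    then have "a1 k * a2 k < 1 * 1" using ord[of k] by (intro mult_strict_mono') auto
    then show False using prod[of k] by simp
  qed
  have "norm (g k) / C \<le> sqrt (a1 k)" for k
  proof -
    have "norm (g k) \<le> sqrt (a1 k) * norm (g0 k)"
      unfolding g by (rule norm_transpose_mult_le[OF es])
    also have "\<dots> \<le> sqrt (a1 k) * C"
      using C a1[of k] by (intro mult_left_mono) auto
    finally show ?thesis using C by (simp add: divide_le_eq)
  qed
  moreover have "sqrt (a1 k) \<le> a1 k" for k
    using a1[of k] by (intro real_le_lsqrt) (auto simp: power2_eq_square)
  ultimately have "norm (g k) / C \<le> a1 k" for k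
    using order_trans by blast
  moreover have "filterlim (\<lambda>k. norm (g k) / C) at_top sequentially"
    using filterlim_tendsto_pos_mult_at_top[OF tendsto_const _ lim, of "1 / C"] C by simp
  ultimately have lim1: "filterlim a1 at_top sequentially"
    by (auto intro: filterlim_at_top_mono)
  have "a2 k = inverse (a1 k)" for k
    using prod[of k] inverse_unique by metis
  then have lim2: "a2 \<longlonglongrightarrow> 0"
    using tendsto_inverse_0_at_top[OF lim1] by presburger
  \<comment> \<open>Where the gradient vanishes, \<open>direction_field\<close> is the zero vector,
    at distance 1 from either sign of \<open>f2 k\<close>, while the right side is 0 by the
    convention for division. Hence the restriction to a positive norm, which holds for all large
    \<open>k\<close>.\<close>
  have ub: "norm (u k - oriented_along (u k) (f2 k)) \<le> sqrt 2 * C / norm (g k)" if pos: "norm (g k) > 0" for k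
  proof -
    define p where "p = perp (g k)"
    have u: "u k = p /\<^sub>R norm (g k)"
      by (simp add: u_def direction_field_def perp_grad_eq_perp p_def g_def)
    \<comment> \<open>As \<open>a1 k\<close> is at least 1, the quadratic form dominates the squared
      \<open>f1 k\<close> component; the decay then comes solely from dividing by the squared norm
      of \<open>g k\<close>.\<close>
    have "(p \<bullet> f1 k)\<^sup>2 \<le> a1 k * (p \<bullet> f1 k)\<^sup>2 + a2 k * (p \<bullet> f2 k)\<^sup>2"
      using a1[of k] ord(2)[of k] mult_right_mono[of 1 "a1 k" "(p \<bullet> f1 k)\<^sup>2"] by (simp add: add_increasing2)
    also have "\<dots> = (norm (J k *v p))\<^sup>2"
      using ordered_eigensystem_diagonalizes(1)[OF es] inner_transpose_mult_self by metis
    also have "J k *v p = perp (g0 k)"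
      unfolding p_def g mult_perp_transpose detJ by simp
    also have "(norm (perp (g0 k)))\<^sup>2 \<le> C\<^sup>2"
      using C by (simp add: power_mono)
    finally have "(u k \<bullet> f1 k)\<^sup>2 \<le> C\<^sup>2 / (norm (g k))\<^sup>2"
      using pos by (simp add: u power_mult_distrib power_inverse field_simps)
    moreover have "norm (u k) = 1"
      using pos by (simp add: u p_def)
    ultimately have "(norm (u k - oriented_along (u k) (f2 k)))\<^sup>2 \<le> 2 * (C\<^sup>2 / (norm (g k))\<^sup>2)"
      using norm_diff_oriented_along_le[OF es] by (meson mult_left_mono order_trans zero_le_numeral)
    also have "\<dots> = (sqrt 2 * C / norm (g k))\<^sup>2"
      by (simp add: power_divide power_mult_distrib)
    finally show ?thesis
      using C pos by (elim power2_le_imp_le) auto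
  qed
  have "(\<lambda>k. sqrt 2 * C / norm (g k)) \<longlonglongrightarrow> 0"
    by (rule real_tendsto_divide_at_top[OF tendsto_const lim])
  moreover have "\<forall>\<^sub>F k in sequentially. norm (u k - oriented_along (u k) (f2 k)) \<le> sqrt 2 * C / norm (g k)"
    using lim unfolding filterlim_at_top_dense by (rule allE[of _ 0]) (auto elim!: eventually_mono intro: ub)
  ultimately have "(\<lambda>k. norm (u k - oriented_along (u k) (f2 k))) \<longlonglongrightarrow> 0"
    by (intro Lim_null_comparison[of "\<lambda>k. norm (u k - oriented_along (u k) (f2 k))"]) simp_all
  with lim1 lim2 show ?thesis by (simp add: a1_def[abs_def] a2_def[abs_def] u_def f2_def)
qed

end
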